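(* Let $\{x_t\}$ be generated by the SA2GD algorithm with stochastic subgradients (see context) with integers $n_a,n_b\ge 1$, and suppose the assumptions listed in the context hold: bounded feasible region (diameter bound $\Theta$), Lipschitz continuous functions (constants $\hat L_a,\hat L_b$), unbiased and bounded stochastic subgradients (constants $\tilde L_a,\tilde L_b$), and convexity. Let $\lambda_*=n_a/(n_a+n_b)$ and let $x_*$ be a minimizer of $S(\cdot,\lambda_* )$ in $\mathcal{X}$. Set $\hat L=\max\{\hat L_a,\hat L_b\}$, $\tilde L=\max\{\tilde L_a,\tilde L_b\}$. If $\bar\alpha$ is any positive constant and the step sizes are $\alpha_t=\frac{\bar\alpha}{\sqrt{t}\,(n_a+n_b)}$ for $t\ge 1$ (with $\alpha_0>0$ arbitrary), then $$\min_{t=1,\ldots,T}\mathbb{E}[S(x_t,\lambda_* )]-\mathbb{E}[S(x_*,\lambda_* )]\;\le\;\frac{\frac{\Theta^2}{2\bar\alpha}+4\bar\alpha\tilde L^2+2\bar\alpha\tilde L\hat L}{\sqrt{T}}.$$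
   Context: Problem: minimize the pair $(f^a(x), f^b(x))$ over $x\in\mathcal{X}$, where $\mathcal{X}\subset\mathbb{R}^n$ is nonempty, compact and convex and the real-valued functions $f^a,f^b$ are possibly non-smooth but subdifferentiable. For $\lambda\in[0,1]$, $S(x,\lambda)=\lambda f^a(x)+(1-\lambda)f^b(x)$. $P_{\mathcal{X}}$ is the orthogonal projection onto $\mathcal{X}$; $\|\cdot\|$ is the Euclidean norm; $\partial f^i(x)$ is the subdifferential of $f^i$ at $x$. SA2GD algorithm: given an initial point $x_0$, step sizes $\alpha_t>0$, and independently drawn random variables $\xi_t^r$ ($0\le r\le n_a+n_b-1$), at each iteration $t=0,1,2,\ldots$ set $y^a_{0,t}=x_t$; for $r=0,\ldots,n_a-1$ set $y^a_{r+1,t}=y^a_{r,t}-\alpha_t g^a(y^a_{r,t},\xi^r_t)$; set $y^b_{0,t}=y^a_{n_a,t}$; for $r=0,\ldots,n_b-1$ set $y^b_{r+1,t}=y^b_{r,t}-\alpha_t g^b(y^b_{r,t},\xi^{n_a+r}_t)$; finally $x_{t+1}=P_{\mathcal{X}}(y^b_{n_b,t})$. Here $g^i(x,\xi)$ is a stochastic subgradient (an unbiased estimator of a subgradient) of $f^i$ at $x$, generated with the random variable $\xi$. Assumptions (for $i\in\{a,b\}$): - Bounded feasible region: $\max_{x,\bar x\in\mathcal{X}}\|x-\bar x\|\le\Theta<\infty$, $\Theta>0$. - Lipschitz functions: $|f^i(\bar x)-f^i(x)|\le\hat L_i\|\bar x-x\|$ for all $(x,\bar x)\in\mathcal{X}\times\mathcal{X}$,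 $\hat L_i>0$. - Stochastic subgradients: for all iterates $t\in\mathbb{N}$, the stochastic subgradients $g^i(x_t,\xi_t)$, generated with random variable $\xi_t$, satisfy $\mathbb{E}_{\xi_t}[g^i(x_t,\xi_t)]\in\partial f^i(x_t)$ and $\mathbb{E}_{\xi_t}[\|g^i(x_t,\xi_t)\|^2]\le\tilde L_i^2$, $\tilde L_i>0$, where $\mathbb{E}_{\xi_t}$ is the conditional expectation with respect to $\xi_t$. - Convexity: $f^i(\bar x)\ge f^i(x)+v^\top(\bar x-x)$ for all $(x,\bar x)\in\mathcal{X}\times\mathcal{X}$ and all $v\in\partial f^i(x)$.
   Formalization: The stochastic subgradient assumption is imposed also at the inner points y^a_{r,t}, y^b_{r,t}, and the subdifferential is the convex one, with the subgradient inequality over all of R^n rather than only on X; with assumptions only at x_t and on X the bound can fail. *)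

theory Defs
  imports "HOL-Probability.Probability"
begin

text \<open>
  The convex subdifferential relative to the whole space. The inner iterates of the algorithm
  are not projected, so subgradients are also taken at points outside the feasible region;
  the subgradient inequality therefore ranges over all \<open>y\<close> and not only over feasible ones.
\<close>

definition subdifferential :: "('v::real_inner \<Rightarrow> real) \<Rightarrow> 'v \<Rightarrow> 'v set" where
  "subdifferential f x = {v. \<forall>y. f x + v \<bullet> (y - x) \<le> f y}"

definition weighted_sum ::
    "('v \<Rightarrow> real) \<Rightarrow> ('v \<Rightarrow> real) \<Rightarrow> 'v \<Rightarrow> real \<Rightarrow> real" where
  "weighted_sum fa fb x l = l * fa x + (1 - l) * fb x"

text \<open>
  Pathwise description of a run of SA2GD: \<open>x t\<close> are the main iterates, \<open>ya t r\<close> and \<open>yb t r\<close>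
  the inner iterates, \<open>\<xi> t r\<close> the \<open>r\<close>-th random draw of iteration \<open>t\<close>.
\<close>

definition sa2gd_run ::
    "'w measure \<Rightarrow> 'v::euclidean_space set \<Rightarrow> ('v \<Rightarrow> 'c \<Rightarrow> 'v) \<Rightarrow> ('v \<Rightarrow> 'c \<Rightarrow> 'v) \<Rightarrow>
     nat \<Rightarrow> nat \<Rightarrow> (nat \<Rightarrow> real) \<Rightarrow> (nat \<Rightarrow> nat \<Rightarrow> 'w \<Rightarrow> 'c) \<Rightarrow> 'v \<Rightarrow>
     (nat \<Rightarrow> 'w \<Rightarrow> 'v) \<Rightarrow> (nat \<Rightarrow> nat \<Rightarrow> 'w \<Rightarrow> 'v) \<Rightarrow> (nat \<Rightarrow> nat \<Rightarrow> 'w \<Rightarrow> 'v) \<Rightarrow> bool" where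
  "sa2gd_run M X ga gb na nb \<alpha> \<xi> x0 x ya yb \<longleftrightarrow>
    (\<forall>\<omega>\<in>space M.
      x 0 \<omega> = x0 \<and>
      (\<forall>t.
        ya t 0 \<omega> = x t \<omega> \<and>
        (\<forall>r<na. ya t (Suc r) \<omega> = ya t r \<omega> - \<alpha> t *\<^sub>R ga (ya t r \<omega>) (\<xi> t r \<omega>)) \<and>
        yb t 0 \<omega> = ya t na \<omega> \<and>
        (\<forall>r<nb. yb t (Suc r) \<omega> = yb t r \<omega> - \<alpha> t *\<^sub>R gb (yb t r \<omega>) (\<xi> t (na + r) \<omega>)) \<and>
        x (Suc t) \<omega> = closest_point X (yb t nb \<omega>)))"

text \<open>
  With the point \<open>p\<close> held fixed, \<open>g p \<zeta>\<close> is an unbiased estimator of a subgradient of \<open>f\<close> at \<open>p\<close>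
  with second moment at most \<open>L\<^sup>2\<close>. Used with \<open>p\<close> the value of an iterate computed before, hence
  independent of, the draw \<open>\<zeta>\<close>, these integrals over \<open>\<zeta>\<close> alone are the values of the
  conditional expectations given the past. The square integrability conjunct is the finiteness
  of the second moment, which the Bochner integral by itself does not express.
\<close>

definition stochastic_subgradient_at ::
    "'w measure \<Rightarrow> ('v::euclidean_space \<Rightarrow> real) \<Rightarrow> real \<Rightarrow> ('v \<Rightarrow> 'c \<Rightarrow> 'v) \<Rightarrow>
     ('w \<Rightarrow> 'c) \<Rightarrow> 'v \<Rightarrow> bool" where
  "stochastic_subgradient_at M f L g \<zeta> p \<longleftrightarrow>
     integral\<^sup>L M (\<lambda>\<omega>. g p (\<zeta> \<omega>)) \<in> subdifferential f p \<and>
     integrable M (\<lambda>\<omega>. (norm (g p (\<zeta> \<omega>)))\<^sup>2) \<and>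
     integral\<^sup>L M (\<lambda>\<omega>. (norm (g p (\<zeta> \<omega>)))\<^sup>2) \<le> L\<^sup>2"

end

theory Submission
  imports Defs
begin

text \<open>
  One pass of \<open>n = na + nb\<close> inner steps started at \<open>x t\<close> acts like a single step of length \<open>n * \<alpha> t\<close>
  along a subgradient of \<open>weighted_sum fa fb _ lam\<close>, which is the average of the inner objectives.
  An inner iterate \<open>y\<close> is independent of the next draw, so Fubini and the subgradient inequality at
  \<open>y\<close> bound the expected descent below by \<open>f y - f xs\<close>, and the subgradient inequality at \<open>x t\<close> bounds
  this by \<open>f (x t) - f xs - L * norm (y - x t)\<close>. The expected drift \<open>norm (y - x t)\<close> after \<open>r\<close> steps
  is at most \<open>r * \<alpha> t * L\<close>, so the errors of a pass add up to \<open>(n * \<alpha> t * L)\<^sup>2\<close>. The projection does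
  not increase the distance to \<open>xs\<close>, and the resulting recursion telescopes with weights \<open>sqrt t\<close>.
\<close>

section \<open>Product laws and Fubini for an independent point and draw\<close>

text \<open>
  \<open>indep_var\<close> forces both random variables to have the same type; between variables of different
  types, independence is expressed by the product form of the joint distribution.
\<close>

lemma (in prob_space) distr_Pair_indep_var:
  assumes indep: "indep_var S P T Q"
    and h [measurable]: "h \<in> measurable S S'" and k [measurable]: "k \<in> measurable T T'"
  shows "distr M (S' \<Otimes>\<^sub>M T') (\<lambda>\<omega>. (h (P \<omega>), k (Q \<omega>))) =
         distr M S' (\<lambda>\<omega>. h (P \<omega>)) \<Otimes>\<^sub>M distr M T' (\<lambda>\<omega>. k (Q \<omega>))"
proof -
  have P [measurable]: "P \<in> measurable M S" and Q [measurable]: "Q \<in> measurable M T"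
    and eq: "distr M S P \<Otimes>\<^sub>M distr M T Q = distr M (S \<Otimes>\<^sub>M T) (\<lambda>x. (P x, Q x))"
    using indep unfolding indep_var_distribution_eq by auto
  have 1: "distr M S' (\<lambda>\<omega>. h (P \<omega>)) = distr (distr M S P) S' h"
    by (subst distr_distr) (auto simp: comp_def)
  have 2: "distr M T' (\<lambda>\<omega>. k (Q \<omega>)) = distr (distr M T Q) T' k"
    by (subst distr_distr) (auto simp: comp_def)
  interpret T: prob_space "distr M T' (\<lambda>\<omega>. k (Q \<omega>))" by (rule prob_space_distr) simp
  have "distr M S' (\<lambda>\<omega>. h (P \<omega>)) \<Otimes>\<^sub>M distr M T' (\<lambda>\<omega>. k (Q \<omega>)) =
      distr (distr M S P \<Otimes>\<^sub>M distr M T Q) (S' \<Otimes>\<^sub>M T') (\<lambda>(x, y). (h x, k y))"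
    unfolding 1 2 by (rule pair_measure_distr) (use T.sigma_finite_measure_axioms 2 in auto)
  also have "\<dots> = distr M (S' \<Otimes>\<^sub>M T') (\<lambda>\<omega>. (h (P \<omega>), k (Q \<omega>)))"
    unfolding eq by (subst distr_distr) (auto simp: comp_def)
  finally show ?thesis ..
qed

context prob_space
begin

text \<open>Tonelli with \<open>Y\<close> frozen: the inner integral, over a second sample point
  \<open>\<omega>'\<close>, is the conditional expectation given \<open>Y\<close>. Being free of
  integrability conditions, this form is what first shows that the second moment of a step is
  finite.\<close>

lemma nn_integral_product_law:
  assumes [measurable]: "Y \<in> measurable M S" "\<zeta> \<in> measurable M N"
    and law: "distr M (S \<Otimes>\<^sub>M N) (\<lambda>\<omega>. (Y \<omega>, \<zeta> \<omega>)) = distr M S Y \<Otimes>\<^sub>M distr M N \<zeta>"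
    and [measurable]: "\<phi> \<in> borel_measurable (S \<Otimes>\<^sub>M N)"
  shows "(\<integral>\<^sup>+\<omega>. \<phi> (Y \<omega>, \<zeta> \<omega>) \<partial>M) = (\<integral>\<^sup>+\<omega>. \<integral>\<^sup>+\<omega>'. \<phi> (Y \<omega>, \<zeta> \<omega>') \<partial>M \<partial>M)"
proof -
  interpret Z: prob_space "distr M N \<zeta>" by (rule prob_space_distr) simp
  have "(\<integral>\<^sup>+\<omega>. \<phi> (Y \<omega>, \<zeta> \<omega>) \<partial>M) = (\<integral>\<^sup>+p. \<phi> p \<partial>distr M (S \<Otimes>\<^sub>M N) (\<lambda>\<omega>. (Y \<omega>, \<zeta> \<omega>)))"
    by (simp add: nn_integral_distr)
  also have "\<dots> = (\<integral>\<^sup>+y. \<integral>\<^sup>+z. \<phi> (y, z) \<partial>distr M N \<zeta> \<partial>distr M S Y)"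
    unfolding law by (simp add: Z.nn_integral_fst)
  also have "\<dots> = (\<integral>\<^sup>+\<omega>. \<integral>\<^sup>+z. \<phi> (Y \<omega>, z) \<partial>distr M N \<zeta> \<partial>M)"
    by (rule nn_integral_distr) (auto intro!: Z.borel_measurable_nn_integral)
  also have "\<dots> = (\<integral>\<^sup>+\<omega>. \<integral>\<^sup>+\<omega>'. \<phi> (Y \<omega>, \<zeta> \<omega>') \<partial>M \<partial>M)"
  proof (rule nn_integral_cong)
    fix \<omega> assume "\<omega> \<in> space M"
    then have [measurable]: "Y \<omega> \<in> space S" by (rule measurable_space[OF assms(1)])
    show "(\<integral>\<^sup>+z. \<phi> (Y \<omega>, z) \<partial>distr M N \<zeta>) = (\<integral>\<^sup>+\<omega>'. \<phi> (Y \<omega>, \<zeta> \<omega>') \<partial>M)"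
      by (rule nn_integral_distr) auto
  qed
  finally show ?thesis .
qed

text \<open>The signed counterpart, for the inner product of a random direction with a displacement.
  Integrability of the inner mean is part of the conclusion because that mean is later compared with
  other integrands.\<close>

lemma integral_product_law:
  fixes \<phi> :: "'b \<times> 'c \<Rightarrow> real"
  assumes [measurable]: "Y \<in> measurable M S" "\<zeta> \<in> measurable M N"
    and law: "distr M (S \<Otimes>\<^sub>M N) (\<lambda>\<omega>. (Y \<omega>, \<zeta> \<omega>)) = distr M S Y \<Otimes>\<^sub>M distr M N \<zeta>"
    and [measurable]: "\<phi> \<in> borel_measurable (S \<Otimes>\<^sub>M N)"
    and int: "integrable M (\<lambda>\<omega>. \<phi> (Y \<omega>, \<zeta> \<omega>))"
  shows "integrable M (\<lambda>\<omega>. \<integral>\<omega>'. \<phi> (Y \<omega>, \<zeta> \<omega>') \<partial>M)" (is ?int)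
    and "(\<integral>\<omega>. \<phi> (Y \<omega>, \<zeta> \<omega>) \<partial>M) = (\<integral>\<omega>. \<integral>\<omega>'. \<phi> (Y \<omega>, \<zeta> \<omega>') \<partial>M \<partial>M)" (is ?eq)
proof -
  interpret D: prob_space "distr M S Y" by (rule prob_space_distr) simp
  interpret Z: prob_space "distr M N \<zeta>" by (rule prob_space_distr) simp
  interpret pair_sigma_finite "distr M S Y" "distr M N \<zeta>" ..
  have int': "integrable (distr M S Y \<Otimes>\<^sub>M distr M N \<zeta>) \<phi>"
    unfolding law[symmetric] using int by (subst integrable_distr_eq) auto
  have inner: "(\<integral>z. \<phi> (Y \<omega>, z) \<partial>distr M N \<zeta>) = (\<integral>\<omega>'. \<phi> (Y \<omega>, \<zeta> \<omega>') \<partial>M)"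
    if "\<omega> \<in> space M" for \<omega>
  proof -
    have [measurable]: "Y \<omega> \<in> space S" using measurable_space[OF assms(1)] that by blast
    show ?thesis by (rule integral_distr) auto
  qed
  have meas: "(\<lambda>y. \<integral>z. \<phi> (y, z) \<partial>distr M N \<zeta>) \<in> borel_measurable S"
    by (rule Z.borel_measurable_lebesgue_integral) auto
  have "integrable M (\<lambda>\<omega>. \<integral>z. \<phi> (Y \<omega>, z) \<partial>distr M N \<zeta>)"
    using integrable_fst'[OF int'] by (subst (asm) integrable_distr_eq) (use meas in auto)
  then show ?int by (rule Bochner_Integration.integrable_cong[THEN iffD1, rotated 2]) (simp_all add: inner)
  have "(\<integral>\<omega>. \<phi> (Y \<omega>, \<zeta> \<omega>) \<partial>M) = (\<integral>p. \<phi> p \<partial>distr M (S \<Otimes>\<^sub>M N) (\<lambda>\<omega>. (Y \<omega>, \<zeta> \<omega>)))"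
    by (simp add: integral_distr)
  also have "\<dots> = (\<integral>y. \<integral>z. \<phi> (y, z) \<partial>distr M N \<zeta> \<partial>distr M S Y)"
    unfolding law using integral_fst'[OF int'] by simp
  also have "\<dots> = (\<integral>\<omega>. \<integral>z. \<phi> (Y \<omega>, z) \<partial>distr M N \<zeta> \<partial>M)"
    by (rule integral_distr) (use meas in auto)
  also have "\<dots> = (\<integral>\<omega>. \<integral>\<omega>'. \<phi> (Y \<omega>, \<zeta> \<omega>') \<partial>M \<partial>M)"
    by (rule Bochner_Integration.integral_cong) (simp_all add: inner)
  finally show ?eq .
qed

section \<open>Moment bounds and square integrability\<close>

lemma expectation_norm_le:
  fixes h :: "'a \<Rightarrow> 'v::euclidean_space"
  assumes [measurable]: "h \<in> borel_measurable M"
    and sq: "integrable M (\<lambda>\<omega>. (norm (h \<omega>))\<^sup>2)" "expectation (\<lambda>\<omega>. (norm (h \<omega>))\<^sup>2) \<le> L\<^sup>2"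
    and L: "L > 0"
  shows "integrable M h" and "expectation (\<lambda>\<omega>. norm (h \<omega>)) \<le> L"
proof -
  have "integrable M (\<lambda>\<omega>. norm (h \<omega>))"
    by (rule square_integrable_imp_integrable) (use sq(1) in simp_all)
  then show int: "integrable M h" by (subst (asm) integrable_norm_iff) simp_all
  \<comment> \<open>The inequality between arithmetic and geometric means, applied to
    \<open>(norm (h \<omega>))\<^sup>2 / L\<close> and \<open>L\<close>, replaces Jensen's
    inequality. The weight \<open>L\<close> makes the two terms balance at the largest admissible
    second moment, so no constant is lost.\<close>
  have *: "norm (h \<omega>) \<le> ((norm (h \<omega>))\<^sup>2 / L + L) / 2" for \<omega>
  proof -
    have "0 \<le> (norm (h \<omega>) - L)\<^sup>2 / L" using L by simp
    also have "\<dots> = (norm (h \<omega>))\<^sup>2 / L - 2 * norm (h \<omega>) + L"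
      using L by (simp add: power2_diff field_simps power2_eq_square)
    finally show ?thesis by simp
  qed
  have "expectation (\<lambda>\<omega>. norm (h \<omega>)) \<le> expectation (\<lambda>\<omega>. ((norm (h \<omega>))\<^sup>2 / L + L) / 2)"
    by (rule integral_mono) (use sq(1) int * in simp_all)
  also have "\<dots> = (expectation (\<lambda>\<omega>. (norm (h \<omega>))\<^sup>2) / L + L) / 2"
    using sq(1) by (simp add: prob_space)
  also have "\<dots> \<le> (L\<^sup>2 / L + L) / 2"
    by (intro divide_right_mono add_right_mono sq(2)) (use L in simp_all)
  also have "\<dots> = L" using L by (simp add: power2_eq_square)
  finally show "expectation (\<lambda>\<omega>. norm (h \<omega>)) \<le> L" .
qed

end

text \<open>By the parallelogram law the two sides differ by exactly
  \<open>(norm (a + b))\<^sup>2\<close>.\<close>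

lemma power2_norm_diff_le:
  fixes a b :: "'v::real_inner"
  shows "(norm (a - b))\<^sup>2 \<le> 2 * (norm a)\<^sup>2 + 2 * (norm b)\<^sup>2"
proof -
  have "0 \<le> (norm (a + b))\<^sup>2" by simp
  then show ?thesis
    by (simp add: power2_norm_eq_inner inner_add inner_diff inner_commute)
qed

lemma (in prob_space) integrable_norm_diff_sq:
  fixes Y G :: "'a \<Rightarrow> 'v::euclidean_space"
  assumes [measurable]: "Y \<in> borel_measurable M" "G \<in> borel_measurable M"
    and "integrable M (\<lambda>\<omega>. (norm (Y \<omega>))\<^sup>2)" "integrable M (\<lambda>\<omega>. (norm (G \<omega>))\<^sup>2)"
  shows "integrable M (\<lambda>\<omega>. (norm (Y \<omega> - G \<omega>))\<^sup>2)"
proof (rule Bochner_Integration.integrable_bound)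
  show "integrable M (\<lambda>\<omega>. 2 * (norm (Y \<omega>))\<^sup>2 + 2 * (norm (G \<omega>))\<^sup>2)" using assms by simp
qed (use power2_norm_diff_le in auto)

lemma (in prob_space) integrable_inner_square:
  fixes Y G :: "'a \<Rightarrow> 'v::euclidean_space"
  assumes [measurable]: "Y \<in> borel_measurable M" "G \<in> borel_measurable M"
    and "integrable M (\<lambda>\<omega>. (norm (Y \<omega>))\<^sup>2)" "integrable M (\<lambda>\<omega>. (norm (G \<omega>))\<^sup>2)"
  shows "integrable M (\<lambda>\<omega>. Y \<omega> \<bullet> G \<omega>)"
proof (rule Bochner_Integration.integrable_bound)
  show "integrable M (\<lambda>\<omega>. (norm (Y \<omega>))\<^sup>2 + (norm (G \<omega>))\<^sup>2)" using assms by simp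
  have "\<bar>a \<bullet> b\<bar> \<le> (norm a)\<^sup>2 + (norm b)\<^sup>2" for a b :: 'v
  proof -
    have "0 \<le> (norm (a + b))\<^sup>2" "0 \<le> (norm (a - b))\<^sup>2"
      "0 \<le> (norm a)\<^sup>2" "0 \<le> (norm b)\<^sup>2" by simp_all
    then show ?thesis
      unfolding power2_norm_eq_inner inner_add inner_diff
      by (simp add: inner_commute inner_diff_left inner_diff_right inner_add_left inner_add_right)
  qed
  then show "AE \<omega> in M. norm (Y \<omega> \<bullet> G \<omega>) \<le> norm ((norm (Y \<omega>))\<^sup>2 + (norm (G \<omega>))\<^sup>2)" by auto
qed simp

section \<open>Expected progress of one inner step and of one whole pass\<close>

context prob_space
begin

text \<open>The mean direction is a true subgradient of norm at most \<open>L\<close>. It therefore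
  bounds how far \<open>f\<close> can fall below \<open>f p\<close> at any point of the space, where
  Lipschitz continuity on the feasible region says nothing.\<close>

lemma stochastic_subgradient_at_mean:
  fixes g :: "'v::euclidean_space \<Rightarrow> 'c \<Rightarrow> 'v"
  assumes [measurable]: "(\<lambda>(z, c). g z c) \<in> borel_measurable (borel \<Otimes>\<^sub>M N)" "\<zeta> \<in> measurable M N"
    and L: "L > 0" and g: "stochastic_subgradient_at M f L g \<zeta> p"
  shows "integrable M (\<lambda>\<omega>. g p (\<zeta> \<omega>))"
    and "norm (expectation (\<lambda>\<omega>. g p (\<zeta> \<omega>))) \<le> L"
    and "f p + expectation (\<lambda>\<omega>. g p (\<zeta> \<omega>)) \<bullet> (y - p) \<le> f y"
proof -
  have *: "(\<lambda>\<omega>. g p (\<zeta> \<omega>)) \<in> borel_measurable M" by measurable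
  note g' = g[unfolded stochastic_subgradient_at_def]
  show "integrable M (\<lambda>\<omega>. g p (\<zeta> \<omega>))"
    using expectation_norm_le(1)[OF * _ _ L] g' by blast
  have "norm (expectation (\<lambda>\<omega>. g p (\<zeta> \<omega>))) \<le> expectation (\<lambda>\<omega>. norm (g p (\<zeta> \<omega>)))"
    by (rule integral_norm_bound)
  also have "\<dots> \<le> L" using expectation_norm_le(2)[OF * _ _ L] g' by blast
  finally show "norm (expectation (\<lambda>\<omega>. g p (\<zeta> \<omega>))) \<le> L" .
  show "f p + expectation (\<lambda>\<omega>. g p (\<zeta> \<omega>)) \<bullet> (y - p) \<le> f y"
    using g' unfolding subdifferential_def by auto
qed

text \<open>In use, \<open>Y\<close> is the current inner iterate, \<open>Z\<close> the start of the
  pass and \<open>u\<close> the minimizer. Progress is expressed through \<open>f\<close> at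
  \<open>Z\<close> so that the gains of all steps of a pass refer to the same point and can be
  added; the price is the drift of \<open>Y\<close> from \<open>Z\<close>.\<close>

lemma stochastic_subgradient_step:
  fixes g :: "'v::euclidean_space \<Rightarrow> 'c \<Rightarrow> 'v" and Y Z :: "'a \<Rightarrow> 'v"
  assumes g [measurable]: "(\<lambda>(z, c). g z c) \<in> borel_measurable (borel \<Otimes>\<^sub>M N)"
    and \<zeta> [measurable]: "\<zeta> \<in> measurable M N"
    and Y [measurable]: "Y \<in> borel_measurable M" and Z [measurable]: "Z \<in> borel_measurable M"
    and law: "distr M (borel \<Otimes>\<^sub>M N) (\<lambda>\<omega>. (Y \<omega>, \<zeta> \<omega>)) = distr M borel Y \<Otimes>\<^sub>M distr M N \<zeta>"
    and Y_sq: "integrable M (\<lambda>\<omega>. (norm (Y \<omega>))\<^sup>2)" and Z_sq: "integrable M (\<lambda>\<omega>. (norm (Z \<omega>))\<^sup>2)"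
    and fZ: "integrable M (\<lambda>\<omega>. f (Z \<omega>))"
    and L: "L > 0" and a: "a \<ge> 0"
    and sg_Y: "AE \<omega> in M. stochastic_subgradient_at M f L g \<zeta> (Y \<omega>)"
    and sg_Z: "AE \<omega> in M. stochastic_subgradient_at M f L g \<zeta> (Z \<omega>)"
  defines "Y' \<equiv> \<lambda>\<omega>. Y \<omega> - a *\<^sub>R g (Y \<omega>) (\<zeta> \<omega>)"
  shows "integrable M (\<lambda>\<omega>. (norm (Y' \<omega>))\<^sup>2)"
    and "expectation (\<lambda>\<omega>. norm (Y' \<omega> - Z \<omega>)) \<le> expectation (\<lambda>\<omega>. norm (Y \<omega> - Z \<omega>)) + a * L"
    and "expectation (\<lambda>\<omega>. (norm (Y' \<omega> - u))\<^sup>2) \<le> expectation (\<lambda>\<omega>. (norm (Y \<omega> - u))\<^sup>2)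
      - 2 * a * (expectation (\<lambda>\<omega>. f (Z \<omega>)) - f u - L * expectation (\<lambda>\<omega>. norm (Y \<omega> - Z \<omega>)))
      + a\<^sup>2 * L\<^sup>2"
proof -
  define G where "G \<omega> = g (Y \<omega>) (\<zeta> \<omega>)" for \<omega>
  have G [measurable]: "G \<in> borel_measurable M" unfolding G_def by measurable
  \<comment> \<open>The moment bound is known only for frozen points, so the random \<open>Y\<close>
    is first frozen by the product law. Working with nonnegative integrals yields integrability and
    the bound together.\<close>
  have "(\<integral>\<^sup>+\<omega>. ennreal ((norm (G \<omega>))\<^sup>2) \<partial>M) =
      (\<integral>\<^sup>+\<omega>. \<integral>\<^sup>+\<omega>'. ennreal ((norm (g (Y \<omega>) (\<zeta> \<omega>')))\<^sup>2) \<partial>M \<partial>M)"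
    unfolding G_def
    using nn_integral_product_law[OF Y \<zeta> law, of "\<lambda>(y, c). ennreal ((norm (g y c))\<^sup>2)"] by simp
  also have "\<dots> \<le> (\<integral>\<^sup>+\<omega>. ennreal (L\<^sup>2) \<partial>M)"
  proof (rule nn_integral_mono_AE)
    show "AE \<omega> in M. (\<integral>\<^sup>+\<omega>'. ennreal ((norm (g (Y \<omega>) (\<zeta> \<omega>')))\<^sup>2) \<partial>M) \<le> ennreal (L\<^sup>2)"
      using sg_Y unfolding stochastic_subgradient_at_def
      by eventually_elim (auto simp: nn_integral_eq_integral intro!: ennreal_leI)
  qed
  also have "\<dots> = ennreal (L\<^sup>2)" by (simp add: emeasure_space_1)
  finally have nn: "(\<integral>\<^sup>+\<omega>. ennreal ((norm (G \<omega>))\<^sup>2) \<partial>M) \<le> ennreal (L\<^sup>2)" .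
  then have "(\<integral>\<^sup>+\<omega>. ennreal ((norm (G \<omega>))\<^sup>2) \<partial>M) < \<infinity>"
    by (rule order.strict_trans1) simp
  then have G_sq: "integrable M (\<lambda>\<omega>. (norm (G \<omega>))\<^sup>2)"
    unfolding integrable_iff_bounded by simp
  have G_le: "expectation (\<lambda>\<omega>. (norm (G \<omega>))\<^sup>2) \<le> L\<^sup>2"
    using nn by (subst (asm) nn_integral_eq_integral[OF G_sq]) auto
  note G_norm = expectation_norm_le[OF G G_sq G_le L]

  have aG_sq: "integrable M (\<lambda>\<omega>. (norm (a *\<^sub>R G \<omega>))\<^sup>2)"
    using G_sq by (simp add: power_mult_distrib)
  show "integrable M (\<lambda>\<omega>. (norm (Y' \<omega>))\<^sup>2)"
    unfolding Y'_def G_def[symmetric] by (rule integrable_norm_diff_sq[OF _ _ Y_sq aG_sq]) simp_all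

  have YZ: "integrable M (\<lambda>\<omega>. norm (Y \<omega> - Z \<omega>))"
    by (rule square_integrable_imp_integrable)
      (use integrable_norm_diff_sq[OF Y Z Y_sq Z_sq] in simp_all)
  have "expectation (\<lambda>\<omega>. norm (Y' \<omega> - Z \<omega>)) \<le> expectation (\<lambda>\<omega>. norm (Y \<omega> - Z \<omega>) + a * norm (G \<omega>))"
  proof (rule integral_mono')
    show "integrable M (\<lambda>\<omega>. norm (Y \<omega> - Z \<omega>) + a * norm (G \<omega>))"
      using YZ G_norm(1) by simp
    show "norm (Y' \<omega> - Z \<omega>) \<le> norm (Y \<omega> - Z \<omega>) + a * norm (G \<omega>)" for \<omega>
      using norm_triangle_ineq4[of "Y \<omega> - Z \<omega>" "a *\<^sub>R G \<omega>"] a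
      by (simp add: Y'_def G_def algebra_simps)
  qed (use a in simp)
  also have "\<dots> = expectation (\<lambda>\<omega>. norm (Y \<omega> - Z \<omega>)) + a * expectation (\<lambda>\<omega>. norm (G \<omega>))"
    using YZ G_norm(1) by simp
  also have "\<dots> \<le> expectation (\<lambda>\<omega>. norm (Y \<omega> - Z \<omega>)) + a * L"
    by (intro add_left_mono mult_left_mono G_norm(2) a)
  finally show "expectation (\<lambda>\<omega>. norm (Y' \<omega> - Z \<omega>)) \<le> expectation (\<lambda>\<omega>. norm (Y \<omega> - Z \<omega>)) + a * L" .

  have Yu_sq: "integrable M (\<lambda>\<omega>. (norm (Y \<omega> - u))\<^sup>2)"
    by (rule integrable_norm_diff_sq[OF Y _ Y_sq]) simp_all
  have GYu: "integrable M (\<lambda>\<omega>. G \<omega> \<bullet> (Y \<omega> - u))"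
    by (rule integrable_inner_square[OF G _ G_sq Yu_sq]) simp
  define \<phi> where "\<phi> = (\<lambda>(y, c). g y c \<bullet> (y - u))"
  have [measurable]: "\<phi> \<in> borel_measurable (borel \<Otimes>\<^sub>M N)" unfolding \<phi>_def by measurable
  have \<phi>_int: "integrable M (\<lambda>\<omega>. \<phi> (Y \<omega>, \<zeta> \<omega>))" using GYu by (simp add: \<phi>_def G_def)
  note prod = integral_product_law[OF Y \<zeta> law _ \<phi>_int]
  have "expectation (\<lambda>\<omega>. f (Z \<omega>)) - f u - L * expectation (\<lambda>\<omega>. norm (Y \<omega> - Z \<omega>))
      = expectation (\<lambda>\<omega>. f (Z \<omega>) - f u - L * norm (Y \<omega> - Z \<omega>))"
    using fZ YZ by (simp add: prob_space)
  also have "\<dots> \<le> expectation (\<lambda>\<omega>. expectation (\<lambda>\<omega>'. \<phi> (Y \<omega>, \<zeta> \<omega>')))"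
  proof (rule integral_mono_AE)
    show "AE \<omega> in M. f (Z \<omega>) - f u - L * norm (Y \<omega> - Z \<omega>) \<le> expectation (\<lambda>\<omega>'. \<phi> (Y \<omega>, \<zeta> \<omega>'))"
      using sg_Y sg_Z
    proof eventually_elim
      case (elim \<omega>)
      note Ym = stochastic_subgradient_at_mean[OF g \<zeta> L elim(1)]
      note Zm = stochastic_subgradient_at_mean[OF g \<zeta> L elim(2)]
      let ?m = "\<lambda>p. expectation (\<lambda>\<omega>'. g p (\<zeta> \<omega>'))"
      \<comment> \<open>Cauchy-Schwarz turns the subgradient at \<open>Z\<close> into the lower
        bound \<open>f (Z \<omega>) - L * norm (Y \<omega> - Z \<omega>)\<close> for
        \<open>f (Y \<omega>)\<close>.\<close>
      have "- (?m (Z \<omega>) \<bullet> (Y \<omega> - Z \<omega>)) \<le> norm (?m (Z \<omega>)) * norm (Y \<omega> - Z \<omega>)"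
        using Cauchy_Schwarz_ineq2[of "?m (Z \<omega>)" "Y \<omega> - Z \<omega>"] by linarith
      also have "\<dots> \<le> L * norm (Y \<omega> - Z \<omega>)" by (intro mult_right_mono Zm(2)) simp
      finally have "f (Z \<omega>) - L * norm (Y \<omega> - Z \<omega>) \<le> f (Y \<omega>)"
        using Zm(3)[of "Y \<omega>"] by linarith
      moreover have "f (Y \<omega>) - f u \<le> ?m (Y \<omega>) \<bullet> (Y \<omega> - u)"
        using Ym(3)[of u] by (simp add: inner_diff_right)
      moreover have "expectation (\<lambda>\<omega>'. \<phi> (Y \<omega>, \<zeta> \<omega>')) = ?m (Y \<omega>) \<bullet> (Y \<omega> - u)"
        unfolding \<phi>_def using Ym(1) by simp
      ultimately show ?case by linarith
    qed
  qed (use fZ YZ prod(1) in simp_all)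
  also have "\<dots> = expectation (\<lambda>\<omega>. G \<omega> \<bullet> (Y \<omega> - u))"
    using prod(2) by (simp add: \<phi>_def G_def)
  finally have descent: "expectation (\<lambda>\<omega>. f (Z \<omega>)) - f u - L * expectation (\<lambda>\<omega>. norm (Y \<omega> - Z \<omega>))
      \<le> expectation (\<lambda>\<omega>. G \<omega> \<bullet> (Y \<omega> - u))" .

  have "(norm (Y' \<omega> - u))\<^sup>2 = (norm (Y \<omega> - u))\<^sup>2 - 2 * a * (G \<omega> \<bullet> (Y \<omega> - u)) + a\<^sup>2 * (norm (G \<omega>))\<^sup>2" for \<omega>
  proof -
    have "Y' \<omega> - u = (Y \<omega> - u) - a *\<^sub>R G \<omega>" by (simp add: Y'_def G_def)
    then show ?thesis
      by (simp only: power2_norm_eq_inner)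
        (simp add: inner_diff_left inner_diff_right inner_commute algebra_simps power2_eq_square)
  qed
  then have "expectation (\<lambda>\<omega>. (norm (Y' \<omega> - u))\<^sup>2) = expectation (\<lambda>\<omega>. (norm (Y \<omega> - u))\<^sup>2)
      - 2 * a * expectation (\<lambda>\<omega>. G \<omega> \<bullet> (Y \<omega> - u)) + a\<^sup>2 * expectation (\<lambda>\<omega>. (norm (G \<omega>))\<^sup>2)"
    using Yu_sq GYu G_sq by simp
  also have "\<dots> \<le> expectation (\<lambda>\<omega>. (norm (Y \<omega> - u))\<^sup>2)
      - 2 * a * (expectation (\<lambda>\<omega>. f (Z \<omega>)) - f u - L * expectation (\<lambda>\<omega>. norm (Y \<omega> - Z \<omega>)))
      + a\<^sup>2 * L\<^sup>2"
    by (intro add_mono diff_left_mono mult_left_mono descent G_le) (use a in auto)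
  finally show "expectation (\<lambda>\<omega>. (norm (Y' \<omega> - u))\<^sup>2) \<le> expectation (\<lambda>\<omega>. (norm (Y \<omega> - u))\<^sup>2)
      - 2 * a * (expectation (\<lambda>\<omega>. f (Z \<omega>)) - f u - L * expectation (\<lambda>\<omega>. norm (Y \<omega> - Z \<omega>)))
      + a\<^sup>2 * L\<^sup>2" .
qed

text \<open>Objective and estimator may change with the step index \<open>r\<close>, so the steps
  for both objectives form one loop. Every step is compared with the start
  \<open>Y 0\<close>.\<close>

lemma stochastic_subgradient_pass:
  fixes g :: "nat \<Rightarrow> 'v::euclidean_space \<Rightarrow> 'c \<Rightarrow> 'v" and Y :: "nat \<Rightarrow> 'a \<Rightarrow> 'v"
  assumes g: "\<And>r. r < n \<Longrightarrow> (\<lambda>(z, c). g r z c) \<in> borel_measurable (borel \<Otimes>\<^sub>M N)"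
    and \<zeta>: "\<And>r. r < n \<Longrightarrow> \<zeta> r \<in> measurable M N"
    and Y: "\<And>r. r \<le> n \<Longrightarrow> Y r \<in> borel_measurable M"
    and law: "\<And>r. r < n \<Longrightarrow> distr M (borel \<Otimes>\<^sub>M N) (\<lambda>\<omega>. (Y r \<omega>, \<zeta> r \<omega>)) =
        distr M borel (Y r) \<Otimes>\<^sub>M distr M N (\<zeta> r)"
    and Y0_sq: "integrable M (\<lambda>\<omega>. (norm (Y 0 \<omega>))\<^sup>2)"
    and f: "\<And>r. r < n \<Longrightarrow> integrable M (\<lambda>\<omega>. f r (Y 0 \<omega>))"
    and L: "L > 0" and a: "a \<ge> 0"
    and sg: "\<And>r. r < n \<Longrightarrow> AE \<omega> in M. \<forall>p\<in>{Y 0 \<omega>, Y r \<omega>}. stochastic_subgradient_at M (f r) L (g r) (\<zeta> r) p"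
    and step: "\<And>r \<omega>. r < n \<Longrightarrow> \<omega> \<in> space M \<Longrightarrow> Y (Suc r) \<omega> = Y r \<omega> - a *\<^sub>R g r (Y r \<omega>) (\<zeta> r \<omega>)"
  shows "integrable M (\<lambda>\<omega>. (norm (Y n \<omega>))\<^sup>2)"
    and "expectation (\<lambda>\<omega>. (norm (Y n \<omega> - u))\<^sup>2) \<le> expectation (\<lambda>\<omega>. (norm (Y 0 \<omega> - u))\<^sup>2)
      - 2 * a * (\<Sum>r<n. expectation (\<lambda>\<omega>. f r (Y 0 \<omega>)) - f r u) + (a * real n * L)\<^sup>2"
proof -
  \<comment> \<open>The drift bound is carried along because the next descent estimate consumes it;
    square integrability is what allows the next step to be applied.\<close>
  have "integrable M (\<lambda>\<omega>. (norm (Y r \<omega>))\<^sup>2) \<and>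
      expectation (\<lambda>\<omega>. norm (Y r \<omega> - Y 0 \<omega>)) \<le> real r * (a * L) \<and>
      expectation (\<lambda>\<omega>. (norm (Y r \<omega> - u))\<^sup>2) \<le> expectation (\<lambda>\<omega>. (norm (Y 0 \<omega> - u))\<^sup>2)
      - 2 * a * (\<Sum>i<r. expectation (\<lambda>\<omega>. f i (Y 0 \<omega>)) - f i u) + (a * real r * L)\<^sup>2"
    if "r \<le> n" for r
    using that
  proof (induction r)
    case 0
    then show ?case using Y0_sq by simp
  next
    case (Suc r)
    then have r: "r < n" and rn: "r \<le> n" by simp_all
    note IH = Suc.IH[OF rn]
    have sg': "AE \<omega> in M. stochastic_subgradient_at M (f r) L (g r) (\<zeta> r) (Y r \<omega>)"
      "AE \<omega> in M. stochastic_subgradient_at M (f r) L (g r) (\<zeta> r) (Y 0 \<omega>)"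
      using sg[OF r] by (auto elim: AE_mp)
    note S = stochastic_subgradient_step[OF g[OF r] \<zeta>[OF r] Y[OF rn] Y[OF le0] law[OF r] conjunct1[OF IH]
        Y0_sq f[OF r] L a sg']
    have 1: "integrable M (\<lambda>\<omega>. (norm (Y (Suc r) \<omega>))\<^sup>2)"
      using S(1) by (rule Bochner_Integration.integrable_cong[THEN iffD1, rotated 2]) (simp_all add: step r)
    have "expectation (\<lambda>\<omega>. norm (Y (Suc r) \<omega> - Y 0 \<omega>)) =
        expectation (\<lambda>\<omega>. norm (Y r \<omega> - a *\<^sub>R g r (Y r \<omega>) (\<zeta> r \<omega>) - Y 0 \<omega>))"
      by (rule Bochner_Integration.integral_cong) (simp_all add: step r)
    with S(2) IH have 2: "expectation (\<lambda>\<omega>. norm (Y (Suc r) \<omega> - Y 0 \<omega>)) \<le> real (Suc r) * (a * L)"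
      by (simp add: algebra_simps)
    have "expectation (\<lambda>\<omega>. (norm (Y (Suc r) \<omega> - u))\<^sup>2) =
        expectation (\<lambda>\<omega>. (norm (Y r \<omega> - a *\<^sub>R g r (Y r \<omega>) (\<zeta> r \<omega>) - u))\<^sup>2)"
      by (rule Bochner_Integration.integral_cong) (simp_all add: step r)
    also note S(3)[of u]
    finally have 3: "expectation (\<lambda>\<omega>. (norm (Y (Suc r) \<omega> - u))\<^sup>2) \<le> expectation (\<lambda>\<omega>. (norm (Y r \<omega> - u))\<^sup>2)
      - 2 * a * (expectation (\<lambda>\<omega>. f r (Y 0 \<omega>)) - f r u - L * expectation (\<lambda>\<omega>. norm (Y r \<omega> - Y 0 \<omega>)))
      + a\<^sup>2 * L\<^sup>2" .
    have "a * (L * expectation (\<lambda>\<omega>. norm (Y r \<omega> - Y 0 \<omega>))) \<le> a * (L * (real r * (a * L)))"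
      using IH L a by (intro mult_left_mono) auto
    \<comment> \<open>In units of \<open>(a * L)\<^sup>2\<close> the error so far is
      \<open>r\<^sup>2\<close>, the drift costs \<open>2 * r\<close> and the second moment of the
      new step costs \<open>1\<close>, which adds up to \<open>(r + 1)\<^sup>2\<close>.\<close>
    with 3 IH have "expectation (\<lambda>\<omega>. (norm (Y (Suc r) \<omega> - u))\<^sup>2) \<le> expectation (\<lambda>\<omega>. (norm (Y 0 \<omega> - u))\<^sup>2)
      - 2 * a * (\<Sum>i<Suc r. expectation (\<lambda>\<omega>. f i (Y 0 \<omega>)) - f i u) + (a * real (Suc r) * L)\<^sup>2"
      by (simp add: algebra_simps power2_eq_square)
    with 1 2 show ?case by blast
  qed
  from this[of n] show "integrable M (\<lambda>\<omega>. (norm (Y n \<omega>))\<^sup>2)"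
    and "expectation (\<lambda>\<omega>. (norm (Y n \<omega> - u))\<^sup>2) \<le> expectation (\<lambda>\<omega>. (norm (Y 0 \<omega> - u))\<^sup>2)
      - 2 * a * (\<Sum>r<n. expectation (\<lambda>\<omega>. f r (Y 0 \<omega>)) - f r u) + (a * real n * L)\<^sup>2"
    by simp_all
qed

end

section \<open>The deterministic recursion with steps proportional to
  \<open>1 / sqrt t\<close>\<close>

text \<open>Dividing the recursion by the step length puts the weight \<open>sqrt t\<close> on
  \<open>D t - D (Suc t)\<close>. The weights increase and \<open>D\<close> is at most
  \<open>\<Theta>\<^sup>2\<close>, so summation by parts leaves only the last weight.\<close>

lemma sum_le_of_sqrt_telescope:
  fixes D s :: "nat \<Rightarrow> real"
  assumes D: "\<And>t. t \<ge> 1 \<Longrightarrow> 0 \<le> D t" "\<And>t. t \<ge> 1 \<Longrightarrow> D t \<le> \<Theta>\<^sup>2" and c: "c > 0"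
    and rec: "\<And>t. t \<ge> 1 \<Longrightarrow> D (Suc t) \<le> D t - 2 * (c / sqrt (real t)) * s t + (c / sqrt (real t) * L)\<^sup>2"
  shows "(\<Sum>t=1..T. s t) \<le> (\<Theta>\<^sup>2 / (2 * c) + c * L\<^sup>2) * sqrt (real T)"
proof -
  have step: "s t \<le> (D t - D (Suc t)) * sqrt (real t) / (2 * c) + c * L\<^sup>2 / (2 * sqrt (real t))"
    if t: "t \<ge> 1" for t
  proof -
    have q: "sqrt (real t) > 0" using t by simp
    have "2 * (c / sqrt (real t)) * s t \<le> D t - D (Suc t) + (c / sqrt (real t) * L)\<^sup>2"
      using rec[OF t] by linarith
    then have "s t \<le> (D t - D (Suc t) + (c / sqrt (real t) * L)\<^sup>2) / (2 * (c / sqrt (real t)))"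
      using q c by (metis divide_pos_pos mult.commute mult_pos_pos pos_le_divide_eq zero_less_numeral)
    also have "\<dots> = (D t - D (Suc t)) * sqrt (real t) / (2 * c) + c * L\<^sup>2 / (2 * sqrt (real t))"
    proof -
      have "(d + (c / q * L)\<^sup>2) / (2 * (c / q)) = d * q / (2 * c) + c * L\<^sup>2 / (2 * q)" if "q > 0" for d q :: real
        using that c by (simp add: field_simps power2_eq_square)
      from this[OF q] show ?thesis .
    qed
    finally show ?thesis .
  qed
  \<comment> \<open>The term \<open>- D (Suc T)\<close> is kept to make the induction close and is
    dropped afterwards. At \<open>T = 0\<close> both sides vanish because
    \<open>sqrt 0 = 0\<close>.\<close>
  have "(\<Sum>t=1..T. s t) \<le> (\<Theta>\<^sup>2 - D (Suc T)) * sqrt (real T) / (2 * c) + c * L\<^sup>2 * sqrt (real T)"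
  proof (induction T)
    case (Suc T)
    let ?p = "sqrt (real T)" and ?q = "sqrt (real (Suc T))"
    have pq: "?p \<le> ?q" "0 < ?q" "0 \<le> ?p" by simp_all
    \<comment> \<open>From \<open>1 = ?q\<^sup>2 - ?p\<^sup>2\<close>: the increment of the square
      root dominates \<open>1 / (2 * ?q)\<close>, so the second-moment terms sum to at most
      \<open>c * L\<^sup>2 * sqrt T\<close>.\<close>
    have "1 = (?q - ?p) * (?q + ?p)" by (simp add: algebra_simps)
    also have "\<dots> \<le> (?q - ?p) * (2 * ?q)" using pq by (intro mult_left_mono) auto
    finally have "1 / (2 * ?q) \<le> ?q - ?p" using pq by (simp add: field_simps)
    then have 1: "c * L\<^sup>2 / (2 * ?q) \<le> c * L\<^sup>2 * (?q - ?p)"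
      using mult_left_mono[of "1 / (2 * ?q)" "?q - ?p" "c * L\<^sup>2"] c by simp
    have "(\<Theta>\<^sup>2 - D (Suc T)) * ?p \<le> (\<Theta>\<^sup>2 - D (Suc T)) * ?q"
      using D(2)[of "Suc T"] pq by (intro mult_left_mono) auto
    then have "(\<Theta>\<^sup>2 - D (Suc T)) * ?p + (D (Suc T) - D (Suc (Suc T))) * ?q
        \<le> (\<Theta>\<^sup>2 - D (Suc (Suc T))) * ?q"
      by (simp add: algebra_simps)
    then have 2: "(\<Theta>\<^sup>2 - D (Suc T)) * ?p / (2 * c) + (D (Suc T) - D (Suc (Suc T))) * ?q / (2 * c)
        \<le> (\<Theta>\<^sup>2 - D (Suc (Suc T))) * ?q / (2 * c)"
      unfolding add_divide_distrib[symmetric] using c by (intro divide_right_mono) auto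
    have "(\<Sum>t=1..Suc T. s t) = (\<Sum>t=1..T. s t) + s (Suc T)" by simp
    also have "\<dots> \<le> ((\<Theta>\<^sup>2 - D (Suc T)) * ?p / (2 * c) + c * L\<^sup>2 * ?p)
        + ((D (Suc T) - D (Suc (Suc T))) * ?q / (2 * c) + c * L\<^sup>2 / (2 * ?q))"
      by (intro add_mono Suc.IH step) simp
    also have "\<dots> \<le> (\<Theta>\<^sup>2 - D (Suc (Suc T))) * ?q / (2 * c) + c * L\<^sup>2 * ?q"
      using 1 2 by (simp add: right_diff_distrib)
    finally show ?case .
  qed simp
  also have "\<dots> \<le> \<Theta>\<^sup>2 * sqrt (real T) / (2 * c) + c * L\<^sup>2 * sqrt (real T)"
    using D(1)[of "Suc T"] c by (intro add_right_mono divide_right_mono mult_right_mono) auto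
  finally show ?thesis by (simp add: algebra_simps)
qed

section \<open>Iterates as functions of past draws, and their independence of the next draw\<close>

text \<open>Measurability with respect to the draws in \<open>K\<close>, encoded as a factorization
  through their joint tuple: independence of disjoint blocks of draws then passes to
  \<open>Y\<close> by composition. Equality is asked on \<open>space M\<close> only, where a run is
  specified.\<close>

definition determined_by ::
    "'w measure \<Rightarrow> 'c measure \<Rightarrow> ('i \<Rightarrow> 'w \<Rightarrow> 'c) \<Rightarrow> 'i set \<Rightarrow> ('w \<Rightarrow> 'v::topological_space) \<Rightarrow> bool" where
  "determined_by M N \<xi> K Y \<longleftrightarrow>
    (\<exists>h\<in>borel_measurable (PiM K (\<lambda>_. N)). \<forall>\<omega>\<in>space M. Y \<omega> = h (\<lambda>i\<in>K. \<xi> i \<omega>))"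

lemma determined_by_const: "(\<And>\<omega>. \<omega> \<in> space M \<Longrightarrow> Y \<omega> = c) \<Longrightarrow> determined_by M N \<xi> K Y"
  unfolding determined_by_def by (rule bexI[of _ "\<lambda>_. c"]) auto

lemma determined_by_compose:
  assumes "determined_by M N \<xi> K Y" "f \<in> borel_measurable borel"
    "\<And>\<omega>. \<omega> \<in> space M \<Longrightarrow> Y' \<omega> = f (Y \<omega>)"
  shows "determined_by M N \<xi> K Y'"
proof -
  obtain h where [measurable]: "h \<in> borel_measurable (PiM K (\<lambda>_. N))"
    and h: "\<And>\<omega>. \<omega> \<in> space M \<Longrightarrow> Y \<omega> = h (\<lambda>i\<in>K. \<xi> i \<omega>)"
    using assms(1) unfolding determined_by_def by auto
  note [measurable] = assms(2)
  show ?thesis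
    unfolding determined_by_def
    by (rule bexI[of _ "\<lambda>c. f (h c)"]) (simp_all add: h assms(3))
qed

text \<open>The enlarged tuple gives back the old one by restriction to \<open>K\<close> and the
  fresh draw as its component \<open>i\<close>.\<close>

lemma determined_by_step:
  fixes g :: "'v::euclidean_space \<Rightarrow> 'c \<Rightarrow> 'v"
  assumes "determined_by M N \<xi> K Y"
    and [measurable]: "(\<lambda>(z, c). g z c) \<in> borel_measurable (borel \<Otimes>\<^sub>M N)"
    and Y': "\<And>\<omega>. \<omega> \<in> space M \<Longrightarrow> Y' \<omega> = Y \<omega> - a *\<^sub>R g (Y \<omega>) (\<xi> i \<omega>)"
  shows "determined_by M N \<xi> (insert i K) Y'"
proof -
  obtain h where [measurable]: "h \<in> borel_measurable (PiM K (\<lambda>_. N))"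
    and h: "\<And>\<omega>. \<omega> \<in> space M \<Longrightarrow> Y \<omega> = h (\<lambda>i\<in>K. \<xi> i \<omega>)"
    using assms(1) unfolding determined_by_def by auto
  have [measurable]: "(\<lambda>c. restrict c K) \<in> measurable (PiM (insert i K) (\<lambda>_. N)) (PiM K (\<lambda>_. N))"
    by (rule measurable_restrict_subset) auto
  have [measurable]: "(\<lambda>c. c i) \<in> measurable (PiM (insert i K) (\<lambda>_. N)) N"
    by (rule measurable_component_singleton) auto
  define h' where "h' c = h (restrict c K) - a *\<^sub>R g (h (restrict c K)) (c i)" for c
  have "h' \<in> borel_measurable (PiM (insert i K) (\<lambda>_. N))" unfolding h'_def by measurable
  moreover have "insert i K \<inter> K = K" by auto
  then have "Y' \<omega> = h' (\<lambda>i\<in>insert i K. \<xi> i \<omega>)" if "\<omega> \<in> space M" for \<omega>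
    using that by (simp add: h'_def h Y' restrict_restrict)
  ultimately show ?thesis unfolding determined_by_def by blast
qed

context prob_space
begin

lemma determined_by_measurable:
  assumes "determined_by M N \<xi> K Y" "\<And>i. i \<in> K \<Longrightarrow> \<xi> i \<in> measurable M N"
  shows "Y \<in> borel_measurable M"
proof -
  obtain h where [measurable]: "h \<in> borel_measurable (PiM K (\<lambda>_. N))"
    and h: "\<And>\<omega>. \<omega> \<in> space M \<Longrightarrow> Y \<omega> = h (\<lambda>i\<in>K. \<xi> i \<omega>)"
    using assms(1) unfolding determined_by_def by auto
  have [measurable]: "(\<lambda>\<omega>. \<lambda>i\<in>K. \<xi> i \<omega>) \<in> measurable M (PiM K (\<lambda>_. N))"
    by (rule measurable_restrict) (rule assms(2))
  have "(\<lambda>\<omega>. h (\<lambda>i\<in>K. \<xi> i \<omega>)) \<in> borel_measurable M" by measurable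
  then show ?thesis by (simp add: h cong: measurable_cong)
qed

lemma determined_by_product_law:
  assumes indep: "indep_vars (\<lambda>_. N) \<xi> I" and K: "K \<subseteq> I" and i: "i \<in> I" "i \<notin> K"
    and Y: "determined_by M N \<xi> K Y"
  shows "distr M (borel \<Otimes>\<^sub>M N) (\<lambda>\<omega>. (Y \<omega>, \<xi> i \<omega>)) = distr M borel Y \<Otimes>\<^sub>M distr M N (\<xi> i)"
proof -
  obtain h where h_meas: "h \<in> borel_measurable (PiM K (\<lambda>_. N))"
    and h: "\<And>\<omega>. \<omega> \<in> space M \<Longrightarrow> Y \<omega> = h (\<lambda>i\<in>K. \<xi> i \<omega>)"
    using Y unfolding determined_by_def by auto
  \<comment> \<open>The single draw is wrapped as a family over \<open>{i}\<close>, which gives both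
    blocks the same type; the projection to component \<open>i\<close> unwraps it.\<close>
  have "indep_var (PiM K (\<lambda>_. N)) (\<lambda>\<omega>. \<lambda>i\<in>K. \<xi> i \<omega>) (PiM {i} (\<lambda>_. N)) (\<lambda>\<omega>. \<lambda>j\<in>{i}. \<xi> j \<omega>)"
    by (rule indep_var_restrict[OF indep]) (use K i in auto)
  from distr_Pair_indep_var[OF this h_meas measurable_component_singleton[of i "{i}" "\<lambda>_. N"]]
  have "distr M (borel \<Otimes>\<^sub>M N) (\<lambda>\<omega>. (h (\<lambda>i\<in>K. \<xi> i \<omega>), \<xi> i \<omega>)) =
      distr M borel (\<lambda>\<omega>. h (\<lambda>i\<in>K. \<xi> i \<omega>)) \<Otimes>\<^sub>M distr M N (\<xi> i)"
    by simp
  moreover have "distr M (borel \<Otimes>\<^sub>M N) (\<lambda>\<omega>. (Y \<omega>, \<xi> i \<omega>)) =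
      distr M (borel \<Otimes>\<^sub>M N) (\<lambda>\<omega>. (h (\<lambda>i\<in>K. \<xi> i \<omega>), \<xi> i \<omega>))"
    by (rule distr_cong) (simp_all add: h)
  moreover have "distr M borel Y = distr M borel (\<lambda>\<omega>. h (\<lambda>i\<in>K. \<xi> i \<omega>))"
    by (rule distr_cong) (simp_all add: h)
  ultimately show ?thesis by simp
qed

section \<open>Integrability over the feasible region and a common moment bound\<close>

text \<open>Continuity is given on \<open>X\<close> only, so measurability goes through the Borel
  sets restricted to \<open>X\<close>; compactness makes the integrand bounded.\<close>

lemma integrable_continuous_compact:
  fixes f :: "'v::euclidean_space \<Rightarrow> real"
  assumes X: "compact X" and f: "continuous_on X f"
    and x: "x \<in> borel_measurable M" "\<And>\<omega>. \<omega> \<in> space M \<Longrightarrow> x \<omega> \<in> X"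
  shows "integrable M (\<lambda>\<omega>. f (x \<omega>))"
proof -
  have "x \<in> measurable M (restrict_space borel X)"
    using x by (intro measurable_restrict_space2) auto
  from measurable_compose[OF this borel_measurable_continuous_on_restrict[OF f]]
  have meas: "(\<lambda>\<omega>. f (x \<omega>)) \<in> borel_measurable M" .
  obtain B where "\<And>z. z \<in> X \<Longrightarrow> norm (f z) \<le> B"
    using compact_imp_bounded[OF compact_continuous_image[OF f X]] unfolding bounded_iff by auto
  then show ?thesis using x(2) by (intro integrable_const_bound[of _ B] meas) auto
qed

end

lemma continuous_on_Lipschitz:
  fixes f :: "'v::real_normed_vector \<Rightarrow> real"
  assumes "L > 0" "\<And>z z'. z \<in> X \<Longrightarrow> z' \<in> X \<Longrightarrow> \<bar>f z' - f z\<bar> \<le> L * norm (z' - z)"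
  shows "continuous_on X f"
proof (rule lipschitz_on_continuous_on)
  show "L-lipschitz_on X f"
    by (rule lipschitz_onI) (use assms in \<open>auto simp: dist_norm\<close>)
qed

lemma stochastic_subgradient_at_mono:
  "stochastic_subgradient_at M f L g \<zeta> p \<Longrightarrow> 0 \<le> L \<Longrightarrow> L \<le> L' \<Longrightarrow> stochastic_subgradient_at M f L' g \<zeta> p"
  unfolding stochastic_subgradient_at_def by (auto intro: order_trans power_mono)

section \<open>The convergence rate of SA2GD\<close>

theorem corollary3p2:
  fixes M :: "'w measure" and N :: "'c measure"
    and X :: "(real ^ 'n) set"
    and fa fb :: "real ^ 'n \<Rightarrow> real"
    and ga gb :: "real ^ 'n \<Rightarrow> 'c \<Rightarrow> real ^ 'n"
    and \<xi> :: "nat \<Rightarrow> nat \<Rightarrow> 'w \<Rightarrow> 'c"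
    and x0 xs :: "real ^ 'n"
    and x :: "nat \<Rightarrow> 'w \<Rightarrow> real ^ 'n"
    and ya yb :: "nat \<Rightarrow> nat \<Rightarrow> 'w \<Rightarrow> real ^ 'n"
    and \<alpha> :: "nat \<Rightarrow> real"
    and \<alpha>bar \<Theta> La_hat Lb_hat La_tilde Lb_tilde L_hat L_tilde lam :: real
    and na nb T :: nat
  assumes "prob_space M"
    and "X \<noteq> {}" "compact X" "convex X"
    and subdifferentiable:
      "\<And>z. z \<in> X \<Longrightarrow> subdifferential fa z \<noteq> {}"
      "\<And>z. z \<in> X \<Longrightarrow> subdifferential fb z \<noteq> {}"
    and "na \<ge> 1" "nb \<ge> 1"
    and g_measurable:
      "(\<lambda>(z, c). ga z c) \<in> borel_measurable (borel \<Otimes>\<^sub>M N)"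
      "(\<lambda>(z, c). gb z c) \<in> borel_measurable (borel \<Otimes>\<^sub>M N)"
    and independent_draws:
      "prob_space.indep_vars M (\<lambda>_. N) (\<lambda>(t, r). \<xi> t r) (UNIV \<times> {..<na + nb})"
    and algorithm: "sa2gd_run M X ga gb na nb \<alpha> \<xi> x0 x ya yb"
    and bounded_region: "\<Theta> > 0"
      "\<And>z z'. z \<in> X \<Longrightarrow> z' \<in> X \<Longrightarrow> norm (z - z') \<le> \<Theta>"
    and Lipschitz_functions: "La_hat > 0" "Lb_hat > 0"
      "\<And>z z'. z \<in> X \<Longrightarrow> z' \<in> X \<Longrightarrow> \<bar>fa z' - fa z\<bar> \<le> La_hat * norm (z' - z)"
      "\<And>z z'. z \<in> X \<Longrightarrow> z' \<in> X \<Longrightarrow> \<bar>fb z' - fb z\<bar> \<le> Lb_hat * norm (z' - z)"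
    and stochastic_subgradients: "La_tilde > 0" "Lb_tilde > 0"
      "\<And>t r. r < na \<Longrightarrow> AE \<omega> in M. \<forall>p\<in>{x t \<omega>, ya t r \<omega>}.
          stochastic_subgradient_at M fa La_tilde ga (\<xi> t r) p"
      "\<And>t r. r < nb \<Longrightarrow> AE \<omega> in M. \<forall>p\<in>{x t \<omega>, yb t r \<omega>}.
          stochastic_subgradient_at M fb Lb_tilde gb (\<xi> t (na + r)) p"
    and convexity:
      "\<And>z z' v. z \<in> X \<Longrightarrow> z' \<in> X \<Longrightarrow> v \<in> subdifferential fa z \<Longrightarrow> fa z' \<ge> fa z + v \<bullet> (z' - z)"
      "\<And>z z' v. z \<in> X \<Longrightarrow> z' \<in> X \<Longrightarrow> v \<in> subdifferential fb z \<Longrightarrow> fb z' \<ge> fb z + v \<bullet> (z' - z)"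
    and lam: "lam = real na / (real na + real nb)"
    and minimizer: "is_arg_min (\<lambda>z. weighted_sum fa fb z lam) (\<lambda>z. z \<in> X) xs"
    and constants: "L_hat = max La_hat Lb_hat" "L_tilde = max La_tilde Lb_tilde"
    and step_sizes: "\<alpha>bar > 0" "\<alpha> 0 > 0"
      "\<And>t. t \<ge> 1 \<Longrightarrow> \<alpha> t = \<alpha>bar / (sqrt (real t) * (real na + real nb))"
    and "T \<ge> 1"
  shows "(MIN t\<in>{1..T}. prob_space.expectation M (\<lambda>\<omega>. weighted_sum fa fb (x t \<omega>) lam))
           - prob_space.expectation M (\<lambda>\<omega>. weighted_sum fa fb xs lam)
         \<le> (\<Theta>\<^sup>2 / (2 * \<alpha>bar) + 4 * \<alpha>bar * L_tilde\<^sup>2 + 2 * \<alpha>bar * L_tilde * L_hat) / sqrt (real T)"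
proof -
  interpret prob_space M by fact
  define n where "n = na + nb"
  \<comment> \<open>The two inner loops are glued into one sequence of \<open>n\<close> steps, which
    is consistent because \<open>yb t 0\<close> equals \<open>ya t na\<close>.\<close>
  define y where "y t r = (if r \<le> na then ya t r else yb t (r - na))" for t r
  define g where "g r = (if r < na then ga else gb)" for r
  define f where "f r = (if r < na then fa else fb)" for r
  define \<zeta> where "\<zeta> = (\<lambda>(t, r). \<xi> t r)"
  \<comment> \<open>The indices of the draws consumed before inner step \<open>r\<close> of
    iteration \<open>t\<close>: all of the earlier iterations and the first \<open>r\<close> of the
    current one.\<close>
  define past where "past t r = {..<t} \<times> {..<n} \<union> {t} \<times> {..<r}" for t r :: nat
  have n: "n \<ge> 1" "real n > 0" using \<open>na \<ge> 1\<close> by (simp_all add: n_def)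
  have L: "L_tilde > 0" using stochastic_subgradients(1) constants by simp
  have indep: "indep_vars (\<lambda>_. N) \<zeta> (UNIV \<times> {..<n})"
    using independent_draws by (simp add: n_def \<zeta>_def)
  have \<zeta>_meas: "\<zeta> i \<in> measurable M N" if "i \<in> UNIV \<times> {..<n}" for i
    using indep that unfolding indep_vars_def by blast
  have g_meas: "(\<lambda>(z, c). g r z c) \<in> borel_measurable (borel \<Otimes>\<^sub>M N)" for r
    using g_measurable by (simp add: g_def)
  have run: "x 0 \<omega> = x0" "y t 0 \<omega> = x t \<omega>" "x (Suc t) \<omega> = closest_point X (y t n \<omega>)"
    if "\<omega> \<in> space M" for t \<omega>
    using algorithm that \<open>na \<ge> 1\<close> \<open>nb \<ge> 1\<close> unfolding sa2gd_run_def y_def n_def by auto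
  have y_step: "y t (Suc r) \<omega> = y t r \<omega> - \<alpha> t *\<^sub>R g r (y t r \<omega>) (\<zeta> (t, r) \<omega>)"
    if r: "r < n" and \<omega>: "\<omega> \<in> space M" for t r \<omega>
  proof -
    have A: "ya t (Suc r) \<omega> = ya t r \<omega> - \<alpha> t *\<^sub>R ga (ya t r \<omega>) (\<xi> t r \<omega>)" if "r < na" for r
      using algorithm \<omega> that unfolding sa2gd_run_def by blast
    have B: "yb t (Suc r) \<omega> = yb t r \<omega> - \<alpha> t *\<^sub>R gb (yb t r \<omega>) (\<xi> t (na + r) \<omega>)" if "r < nb" for r
      using algorithm \<omega> that unfolding sa2gd_run_def by blast
    have C: "yb t 0 \<omega> = ya t na \<omega>" using algorithm \<omega> unfolding sa2gd_run_def by blast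
    show ?thesis
    proof (cases "r < na")
      case True
      then show ?thesis using A by (simp add: y_def g_def \<zeta>_def)
    next
      case False
      then obtain k where k: "r = na + k" by (metis le_Suc_ex not_less)
      with r have "k < nb" by (simp add: n_def)
      \<comment> \<open>For \<open>k = 0\<close> the step starts at \<open>yb t 0\<close>, which
        \<open>y\<close> stores as \<open>ya t na\<close>; \<open>C\<close> bridges the two.\<close>
      then show ?thesis using B[of k] C by (cases k) (simp_all add: k y_def g_def \<zeta>_def)
    qed
  qed
  have X: "closed X" "X \<noteq> {}" "convex X" "compact X"
    using assms(2-4) compact_imp_closed by auto
  \<comment> \<open>Feasibility comes from the projection and so starts at \<open>t = 1\<close>;
    \<open>x0\<close> may lie outside \<open>X\<close>.\<close>
  have xX: "x t \<omega> \<in> X" if "t \<ge> 1" "\<omega> \<in> space M" for t \<omega>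
    using that run(3)[of \<omega> "t - 1"] closest_point_in_set[OF X(1,2)] by simp
  have xs: "xs \<in> X" using minimizer by (simp add: is_arg_min_def)

  have past_sub: "past t r \<subseteq> UNIV \<times> {..<n}" if "r \<le> n" for t r
    using that by (auto simp: past_def)
  \<comment> \<open>Stated relative to the start of the pass, so that the induction over iterations
    for \<open>x t\<close> can call it.\<close>
  have det_y: "determined_by M N \<zeta> (past t r) (y t r)"
    if "determined_by M N \<zeta> (past t 0) (x t)" "r \<le> n" for t r
    using that(2)
  proof (induction r)
    case 0
    then show ?case using determined_by_compose[OF that(1), of "\<lambda>z. z"] run(2) by simp
  next
    case (Suc r)
    then have "determined_by M N \<zeta> (insert (t, r) (past t r)) (y t (Suc r))"
      by (intro determined_by_step[where g = "g r" and a = "\<alpha> t"] g_meas) (auto simp: y_step)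
    moreover have "insert (t, r) (past t r) = past t (Suc r)" by (auto simp: past_def)
    ultimately show ?case by simp
  qed
  have det_x: "determined_by M N \<zeta> (past t 0) (x t)" for t
  proof (induction t)
    case 0
    show ?case by (rule determined_by_const) (rule run(1))
  next
    case (Suc t)
    have "closest_point X \<in> borel_measurable borel"
      by (intro borel_measurable_continuous_onI continuous_on_closest_point X)
    then have "determined_by M N \<zeta> (past t n) (x (Suc t))"
      by (rule determined_by_compose[OF det_y[OF Suc order_refl]]) (rule run(3))
    moreover have "past t n = past (Suc t) 0" by (auto simp: past_def)
    ultimately show ?case by simp
  qed
  note det_y = det_y[OF det_x]
  have y_meas: "y t r \<in> borel_measurable M" if "r \<le> n" for t r
    by (rule determined_by_measurable[OF det_y[OF that]])
      (rule \<zeta>_meas, rule subsetD[OF past_sub[OF that]])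
  have x_meas: "x t \<in> borel_measurable M" for t
    by (rule determined_by_measurable[OF det_x]) (rule \<zeta>_meas, rule subsetD[OF past_sub[OF le0]])
  \<comment> \<open>The draw \<open>(t, r)\<close> is fresh: it does not belong to
    \<open>past t r\<close>, which determines \<open>y t r\<close>.\<close>
  have law: "distr M (borel \<Otimes>\<^sub>M N) (\<lambda>\<omega>. (y t r \<omega>, \<zeta> (t, r) \<omega>)) =
      distr M borel (y t r) \<Otimes>\<^sub>M distr M N (\<zeta> (t, r))" if "r < n" for t r
    by (rule determined_by_product_law[OF indep past_sub _ _ det_y]) (use that in \<open>auto simp: past_def\<close>)

  have f_cont: "continuous_on X (f r)" for r
    using continuous_on_Lipschitz[OF Lipschitz_functions(1,3)]
      continuous_on_Lipschitz[OF Lipschitz_functions(2,4)] by (simp add: f_def)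
  have sg: "AE \<omega> in M. \<forall>p\<in>{y t 0 \<omega>, y t r \<omega>}. stochastic_subgradient_at M (f r) L_tilde (g r) (\<zeta> (t, r)) p"
    if r: "r < n" for t r
  proof (cases "r < na")
    case True
    show ?thesis
      using stochastic_subgradients(3)[OF True, of t] AE_space
      by eventually_elim
        (use True run(2) constants stochastic_subgradients(1) in
          \<open>auto simp: y_def f_def g_def \<zeta>_def intro: stochastic_subgradient_at_mono\<close>)
  next
    case False
    then obtain k where k: "r = na + k" by (metis le_Suc_ex not_less)
    with r have "k < nb" by (simp add: n_def)
    have yb: "y t r \<omega> = yb t k \<omega>" if "\<omega> \<in> space M" for \<omega>
      using algorithm that unfolding sa2gd_run_def by (cases k) (simp_all add: k y_def)
    show ?thesis
      using stochastic_subgradients(4)[OF \<open>k < nb\<close>, of t] AE_space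
      by eventually_elim
        (use run(2) yb k constants stochastic_subgradients(2) in
          \<open>auto simp: f_def g_def \<zeta>_def intro: stochastic_subgradient_at_mono\<close>)
  qed

  define D where "D t = expectation (\<lambda>\<omega>. (norm (x t \<omega> - xs))\<^sup>2)" for t
  define S where "S z = weighted_sum fa fb z lam" for z
  \<comment> \<open>Here \<open>lam\<close> is decisive: \<open>real n * lam = real na\<close>, so a
    pass visits the objectives in exactly the proportions of the weighted sum.\<close>
  have S_sum: "(\<Sum>r<n. f r z) = real n * S z" for z
  proof -
    have "(\<Sum>r<n. f r z) = (\<Sum>r<na. f r z) + (\<Sum>r=na..<na + nb. f r z)"
      by (simp add: n_def lessThan_atLeast0 sum.atLeastLessThan_concat)
    also have "\<dots> = real na * fa z + real nb * fb z" by (simp add: f_def)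
    also have "\<dots> = real n * lam * fa z + (real n - real n * lam) * fb z"
    proof -
      have "real n * lam = real na" using n(2) unfolding lam n_def of_nat_add by simp
      then show ?thesis by (simp add: n_def)
    qed
    also have "\<dots> = real n * S z" by (simp add: S_def weighted_sum_def algebra_simps)
    finally show ?thesis .
  qed
  have x_int: "integrable M (\<lambda>\<omega>. h (x t \<omega>))" if "continuous_on X h" "t \<ge> 1" for h :: "real ^ 'n \<Rightarrow> real" and t
    using xX[OF that(2)] by (rule integrable_continuous_compact[OF X(4) that(1) x_meas])
  have D_nonneg: "0 \<le> D t" for t unfolding D_def by simp
  have D_le: "D t \<le> \<Theta>\<^sup>2" if t: "t \<ge> 1" for t
  proof -
    have "D t \<le> expectation (\<lambda>\<omega>. \<Theta>\<^sup>2)"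
      unfolding D_def
    proof (rule integral_mono)
      show "integrable M (\<lambda>\<omega>. (norm (x t \<omega> - xs))\<^sup>2)"
        by (rule x_int[OF _ t]) (intro continuous_intros)
      show "(norm (x t \<omega> - xs))\<^sup>2 \<le> \<Theta>\<^sup>2" if "\<omega> \<in> space M" for \<omega>
        by (intro power_mono bounded_region(2) xX t that xs) simp
    qed simp
    then show ?thesis by (simp add: prob_space)
  qed
  have rec: "D (Suc t) \<le> D t - 2 * (\<alpha>bar / sqrt (real t)) * (expectation (\<lambda>\<omega>. S (x t \<omega>)) - S xs)
      + (\<alpha>bar / sqrt (real t) * L_tilde)\<^sup>2" if t: "t \<ge> 1" for t
  proof -
    have \<alpha>n: "\<alpha> t * real n = \<alpha>bar / sqrt (real t)"
      using step_sizes(3)[OF t] n by (simp add: n_def)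
    have a: "\<alpha> t \<ge> 0" using step_sizes(1) step_sizes(3)[OF t] by simp
    \<comment> \<open>\<open>y t 0\<close> and \<open>x t\<close> agree only on
      \<open>space M\<close>, so integrals are transferred by congruence.\<close>
    have y0: "expectation (\<lambda>\<omega>. h (y t 0 \<omega>)) = expectation (\<lambda>\<omega>. h (x t \<omega>))"
      "integrable M (\<lambda>\<omega>. h (y t 0 \<omega>)) \<longleftrightarrow> integrable M (\<lambda>\<omega>. h (x t \<omega>))" for h :: "real ^ 'n \<Rightarrow> real"
      by (auto intro!: Bochner_Integration.integral_cong Bochner_Integration.integrable_cong simp: run(2))
    have sq: "integrable M (\<lambda>\<omega>. (norm (y t 0 \<omega>))\<^sup>2)"
      unfolding y0(2)[of "\<lambda>z. (norm z)\<^sup>2"] by (rule x_int[OF _ t]) (intro continuous_intros)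
    have f_int: "integrable M (\<lambda>\<omega>. f r (y t 0 \<omega>))" for r
      unfolding y0(2)[of "f r"] by (rule x_int[OF f_cont t])
    note pass = stochastic_subgradient_pass[of n g N "\<lambda>r. \<zeta> (t, r)" "y t" f L_tilde "\<alpha> t",
        OF g_meas \<zeta>_meas y_meas law sq f_int L a sg y_step]
    have yn_sq: "integrable M (\<lambda>\<omega>. (norm (y t n \<omega>))\<^sup>2)" by (rule pass(1)) auto
    \<comment> \<open>The projection is nonexpansive and fixes the feasible point
      \<open>xs\<close>.\<close>
    have "D (Suc t) \<le> expectation (\<lambda>\<omega>. (norm (y t n \<omega> - xs))\<^sup>2)"
      unfolding D_def
    proof (rule integral_mono)
      show "integrable M (\<lambda>\<omega>. (norm (x (Suc t) \<omega> - xs))\<^sup>2)"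
        by (rule x_int) (intro continuous_intros, simp)
      show "integrable M (\<lambda>\<omega>. (norm (y t n \<omega> - xs))\<^sup>2)"
        by (rule integrable_norm_diff_sq[OF y_meas _ yn_sq]) simp_all
      show "(norm (x (Suc t) \<omega> - xs))\<^sup>2 \<le> (norm (y t n \<omega> - xs))\<^sup>2" if "\<omega> \<in> space M" for \<omega>
        using closest_point_lipschitz[OF X(3,1,2), of "y t n \<omega>" xs] closest_point_self[OF xs] run(3)[OF that, of t]
        by (intro power_mono) (simp_all add: dist_norm)
    qed
    also have "\<dots> \<le> expectation (\<lambda>\<omega>. (norm (y t 0 \<omega> - xs))\<^sup>2)
        - 2 * \<alpha> t * (\<Sum>r<n. expectation (\<lambda>\<omega>. f r (y t 0 \<omega>)) - f r xs) + (\<alpha> t * real n * L_tilde)\<^sup>2"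
      by (rule pass(2)) auto
    also have "expectation (\<lambda>\<omega>. (norm (y t 0 \<omega> - xs))\<^sup>2) = D t"
      unfolding D_def by (rule y0(1)[of "\<lambda>z. (norm (z - xs))\<^sup>2"])
    also have "(\<Sum>r<n. expectation (\<lambda>\<omega>. f r (y t 0 \<omega>)) - f r xs) =
        real n * (expectation (\<lambda>\<omega>. S (x t \<omega>)) - S xs)"
    proof -
      have "(\<Sum>r<n. expectation (\<lambda>\<omega>. f r (y t 0 \<omega>))) = expectation (\<lambda>\<omega>. \<Sum>r<n. f r (y t 0 \<omega>))"
        by (rule Bochner_Integration.integral_sum[symmetric]) (rule f_int)
      also have "\<dots> = real n * expectation (\<lambda>\<omega>. S (y t 0 \<omega>))" by (simp add: S_sum)
      finally show ?thesis using y0(1)[of S] by (simp add: sum_subtractf S_sum right_diff_distrib)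
    qed
    finally show ?thesis unfolding \<alpha>n[symmetric] by (simp add: mult.assoc)
  qed
  let ?m = "MIN t\<in>{1..T}. expectation (\<lambda>\<omega>. S (x t \<omega>))"
  \<comment> \<open>The minimum is at most the average over \<open>1..T\<close>, to which the
    telescoped bound applies.\<close>
  have "real T * (?m - S xs) = (\<Sum>t=1..T. ?m - S xs)" by simp
  also have "\<dots> \<le> (\<Sum>t=1..T. expectation (\<lambda>\<omega>. S (x t \<omega>)) - S xs)"
    by (intro sum_mono diff_right_mono Min_le) auto
  also have "\<dots> \<le> (\<Theta>\<^sup>2 / (2 * \<alpha>bar) + \<alpha>bar * L_tilde\<^sup>2) * sqrt (real T)"
    by (rule sum_le_of_sqrt_telescope[OF D_nonneg D_le step_sizes(1) rec])
  \<comment> \<open>The stated constant exceeds the one obtained by \<open>3 * \<alpha>bar *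
    L_tilde\<^sup>2 + 2 * \<alpha>bar * L_tilde * L_hat\<close>, which is nonnegative.\<close>
  also have "\<dots> \<le> (\<Theta>\<^sup>2 / (2 * \<alpha>bar) + 4 * \<alpha>bar * L_tilde\<^sup>2 + 2 * \<alpha>bar * L_tilde * L_hat) * sqrt (real T)"
    using step_sizes(1) L Lipschitz_functions(1) constants(1) by (intro mult_right_mono) auto
  finally have "(?m - S xs) * real T \<le> (\<Theta>\<^sup>2 / (2 * \<alpha>bar) + 4 * \<alpha>bar * L_tilde\<^sup>2 + 2 * \<alpha>bar * L_tilde * L_hat) * sqrt (real T)"
    by (simp add: mult.commute)
  \<comment> \<open>Writing \<open>T\<close> as \<open>sqrt T * sqrt T\<close> lets one factor
    cancel and leaves the rate \<open>1 / sqrt T\<close>.\<close>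
  then have "(?m - S xs) * sqrt (real T) * sqrt (real T) \<le>
      (\<Theta>\<^sup>2 / (2 * \<alpha>bar) + 4 * \<alpha>bar * L_tilde\<^sup>2 + 2 * \<alpha>bar * L_tilde * L_hat) * sqrt (real T)"
    by (simp add: mult.assoc)
  then have "?m - S xs \<le> (\<Theta>\<^sup>2 / (2 * \<alpha>bar) + 4 * \<alpha>bar * L_tilde\<^sup>2 + 2 * \<alpha>bar * L_tilde * L_hat) / sqrt (real T)"
    using \<open>T \<ge> 1\<close> by (simp add: pos_le_divide_eq)
  then show ?thesis by (simp add: S_def prob_space)
qed

end
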